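(* For every integer $n\ge 1$ and each $k\in\{3,5\}$, $$\mathsf{s}_{k\cdot 3^n}(C_{3^n}^3)=(k+3)3^n-3.$$
   Context: $C_m$ denotes the cyclic group of order $m$, written additively, and $C_m^r$ is the direct sum of $r$ copies of $C_m$. For a finite abelian group $G$ (written additively), a sequence over $G$ is a finite unordered list of elements of $G$ with repetition allowed (a finite multiset); its length is its number of terms counted with multiplicity, and it is zero-sum if the sum of its terms (with multiplicity) is $0$. A subsequence is a sub-multiset. $\exp(G)$ is the exponent of $G$. For a positive integer $k$, $\mathsf{s}_{k\exp(G)}(G)$ denotes the smallest integer $\ell$ such that every sequence over $G$ of length $\ell$ has a zero-sum subsequence of length exactly $k\exp(G)$. For $G=C_{3^n}^3$ one has $\exp(G)=3^n$. *)

theory Defs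
  imports "HOL-Algebra.Algebra" "HOL-Library.Multiset"
begin

text \<open>
  Groups are written multiplicatively in HOL-Algebra: the sum of a sequence becomes
  a product, and zero-sum means that this product is the identity.
\<close>

definition cyclic_power :: "nat \<Rightarrow> nat \<Rightarrow> (nat \<Rightarrow> int) monoid" where
  "cyclic_power m r = product_group {..<r} (\<lambda>_. integer_mod_group m)"

definition group_exponent :: "('a, 'b) monoid_scheme \<Rightarrow> nat" where
  "group_exponent G = (LEAST m. 0 < m \<and> (\<forall>x\<in>carrier G. x [^]\<^bsub>G\<^esub> m = \<one>\<^bsub>G\<^esub>))"

definition seq_sum :: "('a, 'b) monoid_scheme \<Rightarrow> 'a multiset \<Rightarrow> 'a" where
  "seq_sum G S = (\<Otimes>\<^bsub>G\<^esub>x\<in>set_mset S. x [^]\<^bsub>G\<^esub> count S x)"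

definition zero_sum :: "('a, 'b) monoid_scheme \<Rightarrow> 'a multiset \<Rightarrow> bool" where
  "zero_sum G S \<longleftrightarrow> seq_sum G S = \<one>\<^bsub>G\<^esub>"

text \<open>
  The subscript is the required length itself, so \<open>s\<close> with subscript \<open>k exp(G)\<close> is
  \<open>zs_const (k * group_exponent G) G\<close>.  The set of admissible \<open>l\<close> is nonempty in this case
  (lemma \<open>zs_const_exists\<close> below), so the minimum is attained.
\<close>

definition zs_const :: "nat \<Rightarrow> ('a, 'b) monoid_scheme \<Rightarrow> nat" where
  "zs_const m G = (LEAST l. \<forall>S. set_mset S \<subseteq> carrier G \<and> size S = l \<longrightarrow>
     (\<exists>T. T \<subseteq># S \<and> size T = m \<and> zero_sum G T))"

lemma comm_group_cyclic_power: "comm_group (cyclic_power m r)"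
proof (rule group.group_comm_groupI)
  show "group (cyclic_power m r)"
    by (simp add: cyclic_power_def)
qed (auto simp: cyclic_power_def add.commute)

lemma pow_cyclic_power:
  "x [^]\<^bsub>cyclic_power m r\<^esub> (k::nat) = (\<lambda>i\<in>{..<r}. (int k * x i) mod int m)"
proof (induction k)
  case 0
  then show ?case by (simp add: cyclic_power_def)
next
  case (Suc k)
  then show ?case
    by (auto simp: cyclic_power_def fun_eq_iff mod_simps algebra_simps restrict_def)
qed

lemma group_exponent_cyclic_power:
  assumes "0 < m" "0 < r"
  shows "group_exponent (cyclic_power m r) = m"
  unfolding group_exponent_def
proof (rule Least_equality)
  show "0 < m \<and> (\<forall>x\<in>carrier (cyclic_power m r).
          x [^]\<^bsub>cyclic_power m r\<^esub> m = \<one>\<^bsub>cyclic_power m r\<^esub>)"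
    using assms by (simp add: pow_cyclic_power) (simp add: cyclic_power_def)
next
  fix k :: nat assume k: "0 < k \<and> (\<forall>x\<in>carrier (cyclic_power m r).
          x [^]\<^bsub>cyclic_power m r\<^esub> k = \<one>\<^bsub>cyclic_power m r\<^esub>)"
  let ?x = "\<lambda>i\<in>{..<r}. 1 mod int m"
  have "?x \<in> carrier (cyclic_power m r)"
    using assms by (auto simp: cyclic_power_def carrier_integer_mod_group)
  with k have "?x [^]\<^bsub>cyclic_power m r\<^esub> k = \<one>\<^bsub>cyclic_power m r\<^esub>" by blast
  then have "(\<lambda>i\<in>{..<r}. (int k * ?x i) mod int m) = (\<lambda>i\<in>{..<r}. 0)"
    by (simp only: pow_cyclic_power) (simp add: cyclic_power_def)
  from fun_cong[OF this, of 0] have "int k mod int m = 0"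
    using assms by (simp add: mod_mult_right_eq)
  then have "m dvd k" by (simp add: mod_eq_0_iff_dvd)
  with k show "m \<le> k" by (simp add: dvd_imp_le)
qed

text \<open>Taking each term as often as it occurs agrees with adding the terms one at a time.\<close>

lemma (in comm_group) seq_sum_add_mset:
  assumes "x \<in> carrier G" "set_mset S \<subseteq> carrier G"
  shows "seq_sum G (add_mset x S) = x \<otimes> seq_sum G S"
proof -
  let ?f = "\<lambda>S y. y [^] count S y"
  have *: "seq_sum G T = ?f T x \<otimes> finprod G (?f T) (set_mset S - {x})"
    if "set_mset T \<subseteq> insert x (set_mset S)" "set_mset S - {x} \<subseteq> set_mset T" for T
  proof (cases "x \<in># T")
    case True
    then have "set_mset T = insert x (set_mset S - {x})" using that by auto
    then show ?thesis using assms unfolding seq_sum_def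
      by (simp only:) (rule finprod_insert, auto)
  next
    case False
    then have "set_mset T = set_mset S - {x}" using that by auto
    moreover have "finprod G (?f T) (set_mset S - {x}) \<in> carrier G"
      using assms by (intro finprod_closed) auto
    moreover have "count T x = 0" using False by (simp add: not_in_iff)
    ultimately show ?thesis by (simp add: seq_sum_def)
  qed
  have c: "finprod G (?f S) (set_mset S - {x}) \<in> carrier G"
    using assms by (intro finprod_closed) auto
  have e: "finprod G (?f (add_mset x S)) (set_mset S - {x}) = finprod G (?f S) (set_mset S - {x})"
    using assms by (intro finprod_cong') auto
  show ?thesis
    using *[OF subset_insertI Diff_subset] *[of "add_mset x S"] c e assms
    by (auto simp: m_ac subset_insertI subset_insertI2)
qed

lemma (in comm_group) zs_const_exists:
  assumes "finite (carrier G)"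
  shows "\<exists>l. \<forall>S. set_mset S \<subseteq> carrier G \<and> size S = l \<longrightarrow>
    (\<exists>T. T \<subseteq># S \<and> size T = k * group_exponent G \<and> zero_sum G T)"
proof -
  let ?m = "k * group_exponent G"
  have "0 < order G \<and> (\<forall>x\<in>carrier G. x [^] order G = \<one>)"
    using assms by (auto simp: order_gt_0_iff_finite pow_order_eq_1)
  from LeastI[of "\<lambda>m. 0 < m \<and> (\<forall>x\<in>carrier G. x [^] m = \<one>)", OF this]
  have e: "x [^] group_exponent G = \<one>" if "x \<in> carrier G" for x
    using that by (simp add: group_exponent_def)
  have "\<exists>T. T \<subseteq># S \<and> size T = ?m \<and> zero_sum G T"
    if S: "set_mset S \<subseteq> carrier G" "size S = card (carrier G) * ?m + 1" for S
  proof -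
    have "\<exists>x\<in>carrier G. ?m \<le> count S x"
    proof (rule ccontr)
      assume "\<not> ?thesis"
      then have "\<And>x. x \<in> carrier G \<Longrightarrow> count S x \<le> ?m" by fastforce
      then have "(\<Sum>x\<in>carrier G. count S x) \<le> card (carrier G) * ?m"
        using sum_bounded_above[of "carrier G" "count S" ?m] by simp
      moreover have "size S \<le> (\<Sum>x\<in>carrier G. count S x)"
        unfolding size_multiset_overloaded_eq using S assms by (intro sum_mono2) auto
      ultimately show False using S by simp
    qed
    then obtain x where x: "x \<in> carrier G" "?m \<le> count S x" by blast
    have "x [^] ?m = \<one>"
      using x e by (metis mult.commute nat_pow_one nat_pow_pow)
    then have "zero_sum G (replicate_mset ?m x)"
      using x by (simp add: zero_sum_def seq_sum_def)
    then show ?thesis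
      using x by (metis count_le_replicate_mset_subset_eq size_replicate_mset)
  qed
  then show ?thesis by blast
qed

end

theory Submission
  imports Defs "HOL-Library.Product_Plus" "HOL-Computational_Algebra.Polynomial"
begin

text \<open>
  Put \<open>q = 3 ^ n\<close> and attach to every term of a sequence a fourth coordinate 1 that counts the
  length.  The signed sum of a function \<open>\<phi>\<close> over the sums of all subsequences is an iterated
  difference of \<open>\<phi>\<close>, and the function that is \<open>f i\<close> on zero-sum subsequences of length \<open>i * q\<close>
  and 0 elsewhere behaves modulo 3 like a polynomial of degree \<open>3 * (q - 1) + (j * q - 1)\<close> if the
  \<open>j\<close>-th difference of \<open>f\<close> vanishes; modulo 9 the degree grows by only \<open>2 * q / 3\<close>.

  For \<open>k = 3\<close>, take \<open>f i = (i - 1) * (i - 2)\<close>: without zero-sums of length \<open>3 * q\<close> only the empty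
  subsequence survives modulo 3, a contradiction.

  For \<open>k = 5\<close>, suppose that no zero-sum of length \<open>5 * q\<close> exists.  Then none of length \<open>2 * q\<close>
  exists either, since its complement would contain one of length \<open>3 * q\<close>.  With \<open>f i = i - 1\<close> one then
  finds two disjoint zero-sums of length \<open>3 * q\<close>; let \<open>T\<close> be their union.  Passing to complements
  in \<open>T\<close>, its zero-sum subsequences of length divisible by \<open>q\<close> have length 0, \<open>3 * q\<close> or \<open>6 * q\<close>.
  Fix a term of \<open>T\<close> and sum \<open>f i = i - 3\<close> over the zero-sum subsequences containing it: only \<open>T\<close>
  contributes, namely 3 up to sign, but the sum vanishes modulo 9.

  For the lower bound, take \<open>k * q - 1\<close> copies of 0 and \<open>q - 1\<close> copies of each unit vector.
\<close>

section \<open>Iterated differences\<close>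

definition fdiff :: "'a::ab_group_add \<Rightarrow> ('a \<Rightarrow> int) \<Rightarrow> 'a \<Rightarrow> int" where
  "fdiff s f x = f x - f (x + s)"

fun fdiffs :: "'a::ab_group_add list \<Rightarrow> ('a \<Rightarrow> int) \<Rightarrow> 'a \<Rightarrow> int" where
  "fdiffs [] f = f"
| "fdiffs (s # xs) f = fdiffs xs (fdiff s f)"

text \<open>
  \<open>dvd_fdiffs d f\<close> encodes degree bounds: \<open>f\<close> is of degree at most \<open>k\<close> modulo \<open>m\<close> if \<open>d\<close> may be
  chosen as 1 up to \<open>k\<close> and \<open>m\<close> beyond.
\<close>

definition dvd_fdiffs :: "(nat \<Rightarrow> int) \<Rightarrow> ('a::ab_group_add \<Rightarrow> int) \<Rightarrow> bool" where
  "dvd_fdiffs d f \<longleftrightarrow> (\<forall>xs x. d (length xs) dvd fdiffs xs f x)"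

lemma fdiffs_add: "fdiffs xs (\<lambda>x. f x + g x) x = fdiffs xs f x + fdiffs xs g x"
proof (induction xs arbitrary: f g)
  case (Cons s xs)
  have "fdiff s (\<lambda>x. f x + g x) = (\<lambda>x. fdiff s f x + fdiff s g x)"
    by (simp add: fun_eq_iff fdiff_def)
  with Cons show ?case by simp
qed simp

lemma fdiffs_shift: "fdiffs xs (\<lambda>x. f (x + s)) x = fdiffs xs f (x + s)"
proof (induction xs arbitrary: f)
  case (Cons t xs)
  have "fdiff t (\<lambda>x. f (x + s)) = (\<lambda>x. fdiff t f (x + s))"
    by (simp add: fun_eq_iff fdiff_def algebra_simps)
  with Cons show ?case by simp
qed simp

lemma fdiffs_fdiff: "fdiffs xs (fdiff s f) x = fdiffs xs f x - fdiffs xs f (x + s)"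
proof -
  have "fdiffs xs f x = fdiffs xs (\<lambda>x. fdiff s f x + f (x + s)) x"
    by (simp add: fdiff_def)
  then show ?thesis by (simp add: fdiffs_add fdiffs_shift)
qed

lemma dvd_fdiffs_fdiff: "dvd_fdiffs d f \<Longrightarrow> dvd_fdiffs (\<lambda>k. d (Suc k)) (fdiff s f)"
  unfolding dvd_fdiffs_def by (metis fdiffs.simps(2) length_Cons)

lemma dvd_fdiffs_shift: "dvd_fdiffs d f \<Longrightarrow> dvd_fdiffs d (\<lambda>x. f (x + s))"
  unfolding dvd_fdiffs_def by (simp add: fdiffs_shift)

text \<open>By the Leibniz rule each difference falls on one factor, while the other is at most
  shifted. The condition on \<open>u\<close>, \<open>v\<close>, \<open>w\<close> ranges over all
  \<open>a\<close> and \<open>b\<close>, so it survives raising an index by one.\<close>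

lemma dvd_fdiffs_mult:
  assumes "dvd_fdiffs v f" "dvd_fdiffs w g" "\<And>a b. u (a + b) dvd v a * w b"
  shows "dvd_fdiffs u (\<lambda>x. f x * g x)"
proof -
  have "u (length xs) dvd fdiffs xs (\<lambda>x. f x * g x) x" for xs x
    using assms
  proof (induction xs arbitrary: f g u v w)
    case Nil
    from Nil(1,2) have "v 0 dvd f x" "w 0 dvd g x"
      unfolding dvd_fdiffs_def by (auto dest: spec[of _ "[]"])
    with Nil(3)[of 0 0] show ?case by (auto intro: dvd_trans mult_dvd_mono)
  next
    case (Cons s xs)
    have 1: "u (Suc (length xs)) dvd fdiffs xs (\<lambda>x. fdiff s f x * g x) x"
      using Cons.prems by (intro Cons.IH[of "\<lambda>k. v (Suc k)" _ w _ "\<lambda>k. u (Suc k)"] dvd_fdiffs_fdiff)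
        (auto simp flip: add_Suc)
    have 2: "u (Suc (length xs)) dvd fdiffs xs (\<lambda>x. f (x + s) * fdiff s g x) x"
      using Cons.prems
      by (intro Cons.IH[of v _ "\<lambda>k. w (Suc k)" _ "\<lambda>k. u (Suc k)"] dvd_fdiffs_fdiff dvd_fdiffs_shift)
        (auto simp flip: add_Suc_right)
    have "fdiff s (\<lambda>x. f x * g x) = (\<lambda>x. fdiff s f x * g x + f (x + s) * fdiff s g x)"
      by (simp add: fun_eq_iff fdiff_def algebra_simps)
    then show ?case using 1 2 by (simp add: fdiffs_add)
  qed
  then show ?thesis by (simp add: dvd_fdiffs_def)
qed

text \<open>A difference of the composite in direction \<open>s\<close> is a difference of
  \<open>f\<close> in direction \<open>h s\<close>. Bounds in one variable thereby pass to functions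
  of a single coordinate.\<close>

lemma dvd_fdiffs_additive:
  assumes "dvd_fdiffs d f" and h: "\<And>x y. h (x + y) = h x + h y"
  shows "dvd_fdiffs d (\<lambda>x. f (h x))"
proof -
  have "fdiffs xs (\<lambda>x. f (h x)) x = fdiffs (map h xs) f (h x)" for xs x
  proof (induction xs arbitrary: f)
    case (Cons s xs)
    have "fdiff s (\<lambda>x. f (h x)) = (\<lambda>x. fdiff (h s) f (h x))"
      by (simp add: fun_eq_iff fdiff_def h)
    with Cons show ?case by simp
  qed simp
  then show ?thesis using assms(1) unfolding dvd_fdiffs_def by (metis length_map)
qed

text \<open>A step of \<open>s\<close> telescopes into unit steps, forwards or backwards according
  to its sign.\<close>

lemma dvd_fdiff_of_dvd_fdiff_1:
  fixes f :: "int \<Rightarrow> int"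
  assumes "\<And>x. c dvd fdiff 1 f x"
  shows "c dvd fdiff s f x"
proof (induction s rule: int_induct[where k = 0])
  case (step1 i)
  have "fdiff (i + 1) f x = fdiff i f x + fdiff 1 f (x + i)"
    by (simp add: fdiff_def algebra_simps)
  then show ?case using step1 assms by (simp add: dvd_add)
next
  case (step2 i)
  have "fdiff (i - 1) f x = fdiff i f x - fdiff 1 f (x + i - 1)"
    by (simp add: fdiff_def algebra_simps)
  then show ?case using step2 assms by (simp add: dvd_diff)
qed (simp add: fdiff_def)

lemma fdiff_commute: "fdiff s (fdiff t f) = fdiff t (fdiff s f)"
  by (simp add: fun_eq_iff fdiff_def algebra_simps)

text \<open>Differences commute, so by telescoping every step may be traded for a unit step.\<close>

lemma dvd_fdiffs_intI:
  fixes f :: "int \<Rightarrow> int"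
  assumes "\<And>k x. d k dvd (fdiff 1 ^^ k) f x"
  shows "dvd_fdiffs d f"
proof -
  have "d (length xs) dvd fdiffs xs f x" for xs x
    using assms
  proof (induction xs arbitrary: f d)
    case Nil
    from Nil[of 0 x] show ?case by simp
  next
    case (Cons s xs)
    have "d (Suc k) dvd (fdiff 1 ^^ k) (fdiff s f) x" for k x
    proof -
      have "(fdiff 1 ^^ k) (fdiff s f) = fdiff s ((fdiff 1 ^^ k) f)"
        by (induction k) (simp_all add: fdiff_commute)
      moreover have "d (Suc k) dvd fdiff 1 ((fdiff 1 ^^ k) f) y" for y
        using Cons.prems[of "Suc k"] by simp
      ultimately show ?thesis by (simp add: dvd_fdiff_of_dvd_fdiff_1)
    qed
    then show ?case using Cons.IH[of "\<lambda>k. d (Suc k)"] by simp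
  qed
  then show ?thesis by (simp add: dvd_fdiffs_def)
qed

section \<open>Polynomials in the shift operator\<close>

text \<open>The variable acts as the shift by 1, which turns congruences between polynomials into
  congruences between difference operators.\<close>

definition act :: "int poly \<Rightarrow> (int \<Rightarrow> int) \<Rightarrow> int \<Rightarrow> int" where
  "act p f x = (\<Sum>i\<le>Polynomial.degree p. Polynomial.coeff p i * f (x + int i))"

lemma act_altdef:
  assumes "Polynomial.degree p \<le> N"
  shows "act p f x = (\<Sum>i\<le>N. Polynomial.coeff p i * f (x + int i))"
  unfolding act_def using assms
  by (intro sum.mono_neutral_left) (auto simp: coeff_eq_0)

lemma act_0 [simp]: "act 0 f x = 0"
  by (simp add: act_def)

lemma act_pCons [simp]: "act (pCons a p) f x = a * f x + act p f (x + 1)"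
proof -
  have "act (pCons a p) f x
      = (\<Sum>i\<le>Suc (Polynomial.degree p). Polynomial.coeff (pCons a p) i * f (x + int i))"
    by (intro act_altdef degree_pCons_le)
  also have "\<dots> = a * f x + act p f (x + 1)"
    unfolding act_def by (subst sum.atMost_Suc_shift) (simp add: algebra_simps)
  finally show ?thesis .
qed

lemma act_add: "act (p + q) f x = act p f x + act q f x"
  by (subst (1 2 3) act_altdef[where N = "max (Polynomial.degree p) (Polynomial.degree q)"])
    (auto simp: degree_add_le algebra_simps sum.distrib)

lemma act_smult: "act (Polynomial.smult c p) f x = c * act p f x"
  by (induction p arbitrary: x) (simp_all add: algebra_simps)

lemma act_mult: "act (p * q) f x = act p (act q f) x"
  by (induction p arbitrary: x) (simp_all add: act_add act_smult)

lemma act_monom: "act (Polynomial.monom c k) f x = c * f (x + int k)"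
  by (induction k arbitrary: x) (simp_all add: monom_0 monom_Suc algebra_simps)

abbreviation shift_poly :: "nat \<Rightarrow> int poly" where
  "shift_poly k \<equiv> Polynomial.monom 1 k"

lemma act_fdiff: "act (1 - shift_poly k) f = fdiff (int k) f"
proof
  fix x
  have "1 - shift_poly k = [:1:] + Polynomial.monom (- 1) k"
    by (simp add: minus_monom one_pCons)
  then show "act (1 - shift_poly k) f x = fdiff (int k) f x"
    by (simp add: act_add act_monom fdiff_def)
qed

lemma act_fdiff_power: "act ((1 - shift_poly k) ^ j) f = (fdiff (int k) ^^ j) f"
proof (induction j)
  case 0
  show ?case by (simp add: fun_eq_iff one_pCons)
next
  case (Suc j)
  then show ?case by (intro ext) (simp add: act_mult act_fdiff)
qed

lemma shift_poly_power: "shift_poly k ^ j = shift_poly (k * j)"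
  by (simp add: monom_power)

text \<open>Cubing is additive modulo 3, and the odd exponent keeps the minus sign.\<close>

lemma one_minus_shift_power:
  "\<exists>R. (1 - shift_poly 1) ^ (3 ^ n) = 1 - shift_poly (3 ^ n) + 3 * R"
proof (induction n)
  case 0
  show ?case by (rule exI[of _ 0]) simp
next
  case (Suc n)
  define Y where "Y = shift_poly (3 ^ n)"
  from Suc obtain R where R: "(1 - shift_poly 1) ^ (3 ^ n) = 1 - Y + 3 * R"
    unfolding Y_def ..
  have "(1 - shift_poly 1) ^ (3 ^ Suc n) = ((1 - shift_poly 1) ^ (3 ^ n)) ^ 3"
    by (simp add: mult.commute flip: power_mult)
  also have "\<dots> = 1 - Y ^ 3
      + 3 * (Y ^ 2 - Y + 3 * (1 - Y) ^ 2 * R + 9 * (1 - Y) * R ^ 2 + 9 * R ^ 3)"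
    unfolding R by (simp add: eval_nat_numeral algebra_simps)
  also have "Y ^ 3 = shift_poly (3 ^ Suc n)"
    by (simp add: Y_def shift_poly_power mult.commute)
  finally show ?case ..
qed

lemma one_minus_shift_power_mult:
  "\<exists>R. (1 - shift_poly 1) ^ (3 ^ n * j) = (1 - shift_poly (3 ^ n)) ^ j + 3 * R"
proof -
  obtain R where R: "(1 - shift_poly 1) ^ (3 ^ n) = 1 - shift_poly (3 ^ n) + 3 * R"
    using one_minus_shift_power by blast
  have "\<exists>Q. (C + 3 * R) ^ j = C ^ j + 3 * Q" for C
  proof (induction j)
    case 0
    show ?case by (rule exI[of _ 0]) simp
  next
    case (Suc j)
    then obtain Q where "(C + 3 * R) ^ j = C ^ j + 3 * Q" ..
    then have "(C + 3 * R) ^ Suc j = C ^ Suc j + 3 * (C * Q + R * C ^ j + 3 * R * Q)"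
      by (simp add: algebra_simps)
    then show ?case ..
  qed
  then show ?thesis unfolding power_mult R by blast
qed

text \<open>
  With \<open>h = 3 ^ n\<close>, \<open>U = (1 - X) ^ h\<close>, \<open>Y = X ^ h\<close> and \<open>C = 1 - X ^ (3 * h)\<close> the identity
  \<open>(1 - Y) ^ 3 = C - 3 * Y * (1 - Y)\<close> becomes \<open>U ^ 3 = C - 3 * Y * U\<close> modulo 9, so that every
  power of 3 beyond the first costs only \<open>2 * h\<close> further differences.
\<close>

lemma one_minus_shift_power_mod_9:
  shows "\<exists>A B. (1 - shift_poly 1) ^ (5 * 3 ^ n) = A * (1 - shift_poly (3 ^ Suc n)) + 9 * B"
    and "\<exists>A B. (1 - shift_poly 1) ^ (8 * 3 ^ n) = A * (1 - shift_poly (3 ^ Suc n)) ^ 2 + 9 * B"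
proof -
  define Y C where "Y = shift_poly (3 ^ n)" and "C = 1 - shift_poly (3 ^ Suc n)"
  define U where "U = (1 - shift_poly 1) ^ (3 ^ n)"
  have U: "(1 - shift_poly 1) ^ (k * 3 ^ n) = U ^ k" for k
    by (simp add: U_def mult.commute flip: power_mult)
  obtain R where R: "U = 1 - Y + 3 * R"
    using one_minus_shift_power unfolding U_def Y_def by blast
  have C: "C = 1 - Y ^ 3"
    by (simp add: Y_def C_def shift_poly_power mult.commute)
  obtain B where B: "U ^ 3 = C - 3 * Y * U + 9 * B"
  proof
    show "U ^ 3 = C - 3 * Y * U
        + 9 * (Y * R + (1 - Y) ^ 2 * R + 3 * (1 - Y) * R ^ 2 + 3 * R ^ 3)"
      unfolding C R by (simp add: eval_nat_numeral algebra_simps)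
  qed
  \<comment> \<open>One use of \<open>B\<close> leaves \<open>3 * Y * U ^ 3\<close>, whose cube is
    replaced once more; the factor 3 then pushes the new term in \<open>U\<close> into the multiples
    of 9. The extra \<open>U ^ 2\<close> supplies this second cube.\<close>
  have "U ^ 5 = U ^ 2 * U ^ 3"
    by (simp flip: power_add)
  also have "\<dots> = U ^ 2 * C - 3 * Y * U ^ 3 + 9 * B * U ^ 2"
    by (subst B) (simp add: eval_nat_numeral algebra_simps)
  also have "\<dots> = (U ^ 2 - 3 * Y) * C + 9 * (Y ^ 2 * U - 3 * Y * B + B * U ^ 2)"
    unfolding B by (simp add: eval_nat_numeral algebra_simps)
  finally show "\<exists>A B. (1 - shift_poly 1) ^ (5 * 3 ^ n) = A * (1 - shift_poly (3 ^ Suc n)) + 9 * B"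
    unfolding U C_def by - (intro exI, assumption)
  have "U ^ 8 = U ^ 2 * (C - 3 * Y * U + 9 * B) ^ 2"
    by (simp flip: B power_add power_mult)
  also have "\<dots> = U ^ 2 * C ^ 2 - 6 * Y * C * U ^ 3
      + 9 * U ^ 2 * (Y ^ 2 * U ^ 2 + 9 * B ^ 2 + 2 * C * B - 6 * Y * U * B)"
    by (simp add: eval_nat_numeral algebra_simps)
  also have "\<dots> = (U ^ 2 - 6 * Y) * C ^ 2 + 9 * (2 * Y ^ 2 * C * U - 6 * Y * C * B
      + U ^ 2 * (Y ^ 2 * U ^ 2 + 9 * B ^ 2 + 2 * C * B - 6 * Y * U * B))"
    unfolding B by (simp add: eval_nat_numeral algebra_simps)
  finally show "\<exists>A B. (1 - shift_poly 1) ^ (8 * 3 ^ n) = A * (1 - shift_poly (3 ^ Suc n)) ^ 2 + 9 * B"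
    unfolding U C_def by - (intro exI, assumption)
qed

text \<open>Since \<open>P\<close> annihilates \<open>f\<close>, only the multiple of
  \<open>m\<close> survives, also after \<open>k - t\<close> further differences.\<close>

lemma dvd_fdiff_power:
  assumes "(1 - shift_poly 1) ^ t = A * P + of_int m * B" "\<And>x. act P f x = 0" "t \<le> k"
  shows "m dvd (fdiff 1 ^^ k) f x"
proof -
  have z: "act A (\<lambda>_. 0) x = 0" for A x
    by (induction A arbitrary: x) auto
  have p: "act P f = (\<lambda>_. 0)"
    using assms(2) by auto
  let ?Q = "(1 - shift_poly 1) ^ (k - t)"
  have "(1 - shift_poly 1) ^ k = ?Q * (A * P + of_int m * B)"
    using assms(3) by (simp flip: assms(1) power_add)
  also have "\<dots> = ?Q * A * P + Polynomial.smult m (?Q * B)"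
    by (simp add: algebra_simps of_int_poly)
  finally have "act ((1 - shift_poly 1) ^ k) f x = m * act (?Q * B) f x"
    by (simp only: act_add act_smult) (simp add: act_mult p z)
  then have "(fdiff 1 ^^ k) f x = m * act (?Q * B) f x"
    by (simp add: act_fdiff_power)
  then show ?thesis by simp
qed

section \<open>Functions supported on the multiples of the modulus\<close>

definition on_multiples :: "nat \<Rightarrow> (int \<Rightarrow> int) \<Rightarrow> int \<Rightarrow> int" where
  "on_multiples q f x = (if int q dvd x then f (x div int q) else 0)"

text \<open>A step of \<open>q\<close> between multiples of \<open>q\<close> is a unit step for
  \<open>f\<close>.\<close>

lemma act_on_multiples:
  assumes "q > 0" "\<And>x. (fdiff 1 ^^ j) f x = 0"
  shows "act ((1 - shift_poly q) ^ j) (on_multiples q f) x = 0"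
proof -
  have "fdiff (int q) (on_multiples q g) = on_multiples q (fdiff 1 g)" for g
    using assms(1) by (auto simp: fun_eq_iff fdiff_def on_multiples_def)
  then have "(fdiff (int q) ^^ j) (on_multiples q f) = on_multiples q ((fdiff 1 ^^ j) f)"
    by (induction j) auto
  then show ?thesis using assms(2) by (simp add: act_fdiff_power on_multiples_def)
qed

section \<open>Degree bounds modulo 3 and modulo 9\<close>

definition level3 :: "nat \<Rightarrow> nat \<Rightarrow> int" where
  "level3 d k = (if k \<le> d then 1 else 3)"

text \<open>The excess \<open>c\<close> modulo 9 is a common parameter: in products only the degrees
  \<open>d\<close> add up.\<close>

definition level9 :: "nat \<Rightarrow> nat \<Rightarrow> nat \<Rightarrow> int" where
  "level9 c d k = (if k \<le> d then 1 else if k \<le> d + c then 3 else 9)"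

lemma level3_mult: "level3 (d + e) (a + b) dvd level3 d a * level3 e b"
  by (auto simp: level3_def)

text \<open>Beyond order \<open>d + e + c\<close>, either both factors are past their first
  thresholds, giving 3 times 3, or one is not and the other is past its second.\<close>

lemma level9_mult: "level9 c (d + e) (a + b) dvd level9 c d a * level9 c e b"
  by (auto simp: level9_def)

lemma dvd_fdiffs_on_multiples_3:
  assumes "\<And>x. (fdiff 1 ^^ j) f x = 0"
  shows "dvd_fdiffs (level3 (j * 3 ^ n - 1)) (on_multiples (3 ^ n) f)"
proof (rule dvd_fdiffs_intI)
  fix k x
  obtain R where "(1 - shift_poly 1) ^ (3 ^ n * j) = 1 * (1 - shift_poly (3 ^ n)) ^ j + of_int 3 * R"
    using one_minus_shift_power_mult[of n j] by auto
  then have "3 dvd (fdiff 1 ^^ k) (on_multiples (3 ^ n) f) x" if "3 ^ n * j \<le> k"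
    using that assms
    by (intro dvd_fdiff_power[of "3 ^ n * j" 1 "(1 - shift_poly (3 ^ n)) ^ j" 3 R] act_on_multiples)
      auto
  then show "level3 (j * 3 ^ n - 1) k dvd (fdiff 1 ^^ k) (on_multiples (3 ^ n) f) x"
    by (auto simp: level3_def mult.commute)
qed

lemma dvd_fdiffs_on_multiples_9:
  assumes "\<And>x. (fdiff 1 ^^ j) f x = 0" "j \<in> {1, 2}"
  shows "dvd_fdiffs (level9 (2 * 3 ^ n) (j * 3 ^ Suc n - 1)) (on_multiples (3 ^ Suc n) f)"
proof (rule dvd_fdiffs_intI)
  fix k x
  let ?D = "(fdiff 1 ^^ k) (on_multiples (3 ^ Suc n) f) x"
  have "level3 (j * 3 ^ Suc n - 1) (length (replicate k (1::int)))
      dvd fdiffs (replicate k 1) (on_multiples (3 ^ Suc n) f) x"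
    using dvd_fdiffs_on_multiples_3[OF assms(1), of "Suc n"] unfolding dvd_fdiffs_def by blast
  moreover have "fdiffs (replicate k s) g = (fdiff s ^^ k) g" for s :: int and g
    by (induction k arbitrary: g) (simp_all add: funpow_swap1)
  ultimately have 3: "level3 (j * 3 ^ Suc n - 1) k dvd ?D" by simp
  \<comment> \<open>The exponent is \<open>5 * 3 ^ n\<close> or \<open>8 * 3 ^ n\<close>, that is,
    \<open>2 * 3 ^ n\<close> more than the \<open>j * 3 ^ Suc n\<close> differences that suffice
    modulo 3.\<close>
  have "\<exists>A B. (1 - shift_poly 1) ^ ((3 * j + 2) * 3 ^ n)
      = A * (1 - shift_poly (3 ^ Suc n)) ^ j + of_int 9 * B"
    using assms(2) one_minus_shift_power_mod_9[of n] by (elim insertE) simp_all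
  then obtain A B where AB: "(1 - shift_poly 1) ^ ((3 * j + 2) * 3 ^ n)
      = A * (1 - shift_poly (3 ^ Suc n)) ^ j + of_int 9 * B" by blast
  have "9 dvd ?D" if "(3 * j + 2) * 3 ^ n \<le> k"
    using that assms(1) by (intro dvd_fdiff_power[OF AB] act_on_multiples) auto
  then show "level9 (2 * 3 ^ n) (j * 3 ^ Suc n - 1) k dvd ?D"
    using 3 by (auto simp: level3_def level9_def algebra_simps split: if_splits)
qed

definition test_fun :: "nat \<Rightarrow> (int \<Rightarrow> int) \<Rightarrow> int \<times> int \<times> int \<times> int \<Rightarrow> int" where
  "test_fun q f v = on_multiples q (\<lambda>_. 1) (fst v) * (on_multiples q (\<lambda>_. 1) (fst (snd v))
     * (on_multiples q (\<lambda>_. 1) (fst (snd (snd v))) * on_multiples q f (snd (snd (snd v)))))"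

lemma test_fun_eq:
  "test_fun q f (a, b, c, l) =
     (if int q dvd a \<and> int q dvd b \<and> int q dvd c \<and> int q dvd l then f (l div int q) else 0)"
  by (auto simp: test_fun_def on_multiples_def)

lemma dvd_fdiffs_test_fun:
  assumes "dvd_fdiffs (L d) (on_multiples q (\<lambda>_. 1))" "dvd_fdiffs (L e) (on_multiples q f)"
    and L: "\<And>a b d e. L (d + e) (a + b) dvd L d a * L e b"
  shows "dvd_fdiffs (L (d + (d + (d + e)))) (test_fun q f)"
proof -
  have M: "dvd_fdiffs (L a) g \<Longrightarrow> dvd_fdiffs (L b) h \<Longrightarrow> dvd_fdiffs (L (a + b)) (\<lambda>x. g x * h x)"
    for a b and g h :: "int \<times> int \<times> int \<times> int \<Rightarrow> int"
    by (erule (1) dvd_fdiffs_mult) (rule L)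
  show ?thesis
    unfolding test_fun_def
    by (rule M[OF dvd_fdiffs_additive[OF assms(1)] M[OF dvd_fdiffs_additive[OF assms(1)]
          M[OF dvd_fdiffs_additive[OF assms(1)] dvd_fdiffs_additive[OF assms(2)]]]]) simp_all
qed

lemma three_dvd_fdiffs_test_fun:
  assumes "\<And>x. (fdiff 1 ^^ j) f x = 0" "j > 0" "length xs \<ge> (j + 3) * 3 ^ n - 3"
  shows "3 dvd fdiffs xs (test_fun (3 ^ n) f) x"
proof -
  let ?q = "3 ^ n :: nat"
  \<comment> \<open>The degrees add up to \<open>(j + 3) * 3 ^ n - 4\<close>, one less than the
    guaranteed number of differences.\<close>
  define d where "d = (?q - 1) + ((?q - 1) + ((?q - 1) + (j * ?q - 1)))"
  have "?q > 0" "j * ?q > 0" using assms(2) by auto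
  then have "length xs > d"
    using assms(3) unfolding d_def add_mult_distrib by linarith
  moreover have "dvd_fdiffs (level3 (1 * 3 ^ n - 1)) (on_multiples (3 ^ n) (\<lambda>_. 1))"
    by (rule dvd_fdiffs_on_multiples_3) (simp add: fdiff_def)
  then have "dvd_fdiffs (level3 d) (test_fun ?q f)"
    unfolding d_def
    by (intro dvd_fdiffs_test_fun level3_mult dvd_fdiffs_on_multiples_3 assms(1)) simp
  then have "level3 d (length xs) dvd fdiffs xs (test_fun ?q f) x"
    unfolding dvd_fdiffs_def by blast
  ultimately show ?thesis by (simp add: level3_def)
qed

lemma nine_dvd_fdiffs_test_fun:
  assumes "\<And>x. (fdiff 1 ^^ 2) f x = 0" "length xs \<ge> 6 * 3 ^ Suc n - 1"
  shows "9 dvd fdiffs xs (test_fun (3 ^ Suc n) f) x"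
proof -
  let ?q = "3 ^ Suc n :: nat" and ?c = "2 * 3 ^ n :: nat"
  define d where "d = (?q - 1) + ((?q - 1) + ((?q - 1) + (2 * ?q - 1)))"
  \<comment> \<open>With \<open>h = 3 ^ n\<close>, the bound \<open>d + ?c\<close> is
    \<open>17 * h - 4\<close>, below \<open>18 * h - 1\<close>.\<close>
  have "(3 ^ n :: nat) > 0" by simp
  then have "length xs > d + ?c" using assms(2) unfolding d_def power_Suc by linarith
  moreover have "dvd_fdiffs (level9 ?c (1 * 3 ^ Suc n - 1)) (on_multiples (3 ^ Suc n) (\<lambda>_. 1))"
    by (rule dvd_fdiffs_on_multiples_9) (simp_all add: fdiff_def)
  then have "dvd_fdiffs (level9 ?c d) (test_fun ?q f)"
    unfolding d_def using assms(1)
    by (intro dvd_fdiffs_test_fun[where L = "level9 ?c"] level9_mult dvd_fdiffs_on_multiples_9) simp_all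
  then have "level9 ?c d (length xs) dvd fdiffs xs (test_fun ?q f) x"
    unfolding dvd_fdiffs_def by blast
  ultimately show ?thesis by (simp add: level9_def)
qed

section \<open>From differences to subsequences\<close>

lemma subseteq_add_msetI: "A \<subseteq># B \<Longrightarrow> A \<subseteq># add_mset x B"
  by (auto simp: subseteq_mset_def le_SucI)

text \<open>An iterated difference at \<open>p\<close> is a signed sum of values of
  \<open>\<phi>\<close> at \<open>p\<close> plus the subsequence sums; the induction splits by
  whether the first term is taken.\<close>

lemma dvd_fdiffsI:
  assumes "\<And>Z. Z \<subseteq># mset xs \<Longrightarrow> m dvd \<phi> (p + (\<Sum>x\<in>#Z. g x))"
  shows "m dvd fdiffs (map g xs) \<phi> p"
  using assms
proof (induction xs arbitrary: p)
  case Nil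
  from Nil[of "{#}"] show ?case by simp
next
  case (Cons x xs)
  have "m dvd fdiffs (map g xs) \<phi> p"
    by (rule Cons.IH) (simp add: Cons.prems subseteq_add_msetI)
  moreover have "m dvd fdiffs (map g xs) \<phi> (p + g x)"
    using Cons.prems[of "add_mset x _"] by (intro Cons.IH) (simp add: add.assoc)
  ultimately show ?case by (simp add: fdiffs_fdiff dvd_diff)
qed

lemma dvd_fdiffs_iff_empty:
  assumes "\<And>Z. Z \<subseteq># mset xs \<Longrightarrow> Z \<noteq> {#} \<Longrightarrow> m dvd \<phi> (p + (\<Sum>x\<in>#Z. g x))"
  shows "m dvd fdiffs (map g xs) \<phi> p \<longleftrightarrow> m dvd \<phi> p"
  using assms
proof (induction xs)
  case (Cons x xs)
  have "m dvd fdiffs (map g xs) \<phi> p \<longleftrightarrow> m dvd \<phi> p"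
    by (rule Cons.IH) (simp add: Cons.prems subseteq_add_msetI)
  moreover have "m dvd fdiffs (map g xs) \<phi> (p + g x)"
    using Cons.prems[of "add_mset x _"] by (intro dvd_fdiffsI) (simp add: add.assoc)
  ultimately show ?case by (simp add: fdiffs_fdiff dvd_diff_left_iff)
qed simp

text \<open>Only the branch that takes the first term is kept, since a subsequence omitting it is
  proper.\<close>

lemma dvd_fdiffs_iff_full:
  assumes "\<And>Z. Z \<subset># mset xs \<Longrightarrow> m dvd \<phi> (p + (\<Sum>x\<in>#Z. g x))"
  shows "m dvd fdiffs (map g xs) \<phi> p \<longleftrightarrow> m dvd \<phi> (p + (\<Sum>x\<in>#mset xs. g x))"
  using assms
proof (induction xs arbitrary: p)
  case (Cons x xs)
  have "m dvd fdiffs (map g xs) \<phi> p"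
    by (intro dvd_fdiffsI Cons.prems) (simp add: subset_mset.le_less_trans)
  moreover have "m dvd fdiffs (map g xs) \<phi> (p + g x) \<longleftrightarrow>
      m dvd \<phi> (p + g x + (\<Sum>x\<in>#mset xs. g x))"
    using Cons.prems[of "add_mset x _"] by (intro Cons.IH) (simp add: add.assoc)
  ultimately show ?case by (simp add: fdiffs_fdiff dvd_diff_right_iff add.assoc)
qed simp

text \<open>Integer representatives are added without reduction, so that the sums lie in the group
  where the differences are taken.\<close>

definition zsum :: "nat \<Rightarrow> nat \<Rightarrow> (nat \<Rightarrow> int) multiset \<Rightarrow> bool" where
  "zsum q r Z \<longleftrightarrow> (\<forall>i<r. int q dvd (\<Sum>x\<in>#Z. x i))"

lemma zsum_add: "zsum q r A \<Longrightarrow> zsum q r B \<Longrightarrow> zsum q r (A + B)"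
  by (simp add: zsum_def)

lemma zsum_diff:
  assumes "A \<subseteq># B" "zsum q r A" "zsum q r B"
  shows "zsum q r (B - A)"
  unfolding zsum_def
proof (intro allI impI)
  fix i assume "i < r"
  from assms(1) obtain C where "B = A + C" by (auto simp: mset_subset_eq_exists_conv)
  then show "int q dvd (\<Sum>x\<in>#B - A. x i)"
    using assms(2,3) \<open>i < r\<close> by (auto simp: zsum_def dvd_add_right_iff)
qed

definition embed :: "(nat \<Rightarrow> int) \<Rightarrow> int \<times> int \<times> int \<times> int" where
  "embed x = (x 0, x 1, x 2, 1)"

lemma test_fun_embed:
  "test_fun q f (\<Sum>x\<in>#Z. embed x) =
     (if zsum q 3 Z \<and> q dvd size Z then f (int (size Z div q)) else 0)"
proof -
  have "(\<Sum>x\<in>#Z. embed x) =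
      (\<Sum>x\<in>#Z. x 0, \<Sum>x\<in>#Z. x 1, \<Sum>x\<in>#Z. x 2, int (size Z))"
    by (induction Z) (simp_all add: embed_def zero_prod_def)
  then show ?thesis
    by (simp add: test_fun_eq zsum_def numeral_3_eq_3 All_less_Suc zdiv_int conj_ac numeral_2_eq_2)
qed

lemma three_dvd_at_0_of_zsum:
  assumes "size S = (j + 3) * 3 ^ n - 3" "j > 0" "\<And>x. (fdiff 1 ^^ j) f x = 0"
    and "\<And>i Z. 0 < i \<Longrightarrow> i < j + 3 \<Longrightarrow> Z \<subseteq># S \<Longrightarrow> size Z = i * 3 ^ n \<Longrightarrow> zsum (3 ^ n) 3 Z
      \<Longrightarrow> 3 dvd f (int i)"
  shows "3 dvd f 0"
proof -
  obtain xs where xs: "mset xs = S" using ex_mset by blast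
  have "3 dvd test_fun (3 ^ n) f (0 + (\<Sum>x\<in>#Z. embed x))" if Z: "Z \<subseteq># mset xs" "Z \<noteq> {#}" for Z
  proof (cases "zsum (3 ^ n) 3 Z \<and> 3 ^ n dvd size Z")
    case True
    then obtain i where i: "size Z = i * 3 ^ n" by (auto elim: dvdE)
    \<comment> \<open>This rules out truncation in \<open>(j + 3) * 3 ^ n - 3\<close>, so that the
      length of \<open>Z\<close> is strictly below \<open>(j + 3) * 3 ^ n\<close>.\<close>
    have "(j + 3) * 3 ^ n \<ge> (3 * 1 :: nat)" by (intro mult_le_mono) auto
    moreover have "i * 3 ^ n \<le> (j + 3) * 3 ^ n - 3"
      using size_mset_mono[OF Z(1)] assms(1) xs i by simp
    ultimately have "i * 3 ^ n < (j + 3) * 3 ^ n" by linarith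
    then have "i < j + 3" by simp
    moreover have "0 < i" using i Z(2) by (cases i) auto
    ultimately have "3 dvd f (int i)" using assms(4) Z(1) xs i True by blast
    then show ?thesis using True i by (simp add: test_fun_embed)
  qed (auto simp: test_fun_embed)
  then have "3 dvd fdiffs (map embed xs) (test_fun (3 ^ n) f) 0 \<longleftrightarrow> 3 dvd test_fun (3 ^ n) f 0"
    by (rule dvd_fdiffs_iff_empty)
  moreover have "length xs = size S" using xs by auto
  then have "3 dvd fdiffs (map embed xs) (test_fun (3 ^ n) f) 0"
    using assms(1-3) by (intro three_dvd_fdiffs_test_fun) auto
  ultimately show ?thesis using test_fun_embed[of "3 ^ n" f "{#}"] by (simp add: zsum_def)
qed

section \<open>The upper bounds for \<open>k = 3\<close> and \<open>k = 5\<close>\<close>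

lemma submultiset_of_size:
  assumes "k \<le> size S"
  obtains T where "T \<subseteq># S" "size T = k"
proof -
  obtain xs where xs: "mset xs = S" using ex_mset by blast
  have "mset xs = mset (take k xs) + mset (drop k xs)"
    by (simp flip: mset_append)
  then have "mset (take k xs) \<subseteq># S" using xs by simp
  moreover have "size (mset (take k xs)) = k" using assms xs by auto
  ultimately show ?thesis by (rule that)
qed

lemma zsum_3_times:
  assumes "size S \<ge> 6 * 3 ^ n - 3"
  shows "\<exists>Z. Z \<subseteq># S \<and> size Z = 3 * 3 ^ n \<and> zsum (3 ^ n) 3 Z"
proof (rule ccontr)
  assume none: "\<not> ?thesis"
  obtain T where T: "T \<subseteq># S" "size T = 6 * 3 ^ n - 3"
    using assms by (rule submultiset_of_size)
  \<comment> \<open>Modulo 3 it vanishes at 1, 2, 4, 5 but is 2 at 0.\<close>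
  define f where "f = (\<lambda>i::int. (i - 1) * (i - 2))"
  have "3 dvd f 0"
  proof (rule three_dvd_at_0_of_zsum)
    show "size T = (3 + 3) * 3 ^ n - 3" using T by simp
    show "(fdiff 1 ^^ 3) f x = 0" for x
      by (simp add: f_def eval_nat_numeral fdiff_def algebra_simps)
    fix i Z assume "0 < i" "i < (3::nat) + 3" "Z \<subseteq># T" "size Z = i * 3 ^ n" "zsum (3 ^ n) 3 Z"
    with none T(1) have "i \<in> {1, 2, 4, 5}" by (cases "i = 3") auto
    then show "3 dvd f (int i)" by (auto simp: f_def)
  qed simp
  then show False by (simp add: f_def)
qed

lemma zsum_5_times:
  assumes "n \<ge> 1" and S: "size S = 8 * 3 ^ n - 3"
  shows "\<exists>Z. Z \<subseteq># S \<and> size Z = 5 * 3 ^ n \<and> zsum (3 ^ n) 3 Z"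
proof (rule ccontr)
  assume "\<not> ?thesis"
  then have no5: False if "Z \<subseteq># S" "size Z = 5 * 3 ^ n" "zsum (3 ^ n) 3 Z" for Z
    using that by blast
  have q: "3 ^ n \<ge> (3 :: nat)"
    using assms(1) power_increasing[of 1 n "3::nat"] by simp
  have no2: False if Z: "Z \<subseteq># S" "size Z = 2 * 3 ^ n" "zsum (3 ^ n) 3 Z" for Z
  proof -
    have "size (S - Z) = 6 * 3 ^ n - 3"
      using Z S by (simp add: size_Diff_submset)
    then obtain B where B: "B \<subseteq># S - Z" "size B = 3 * 3 ^ n" "zsum (3 ^ n) 3 B"
      using zsum_3_times[of n "S - Z"] by auto
    have "Z + B \<subseteq># S"
      using Z(1) B(1) by (metis subset_mset.add_diff_inverse subset_mset.add_left_mono)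
    with no5[of "Z + B"] Z B show False by (simp add: zsum_add)
  qed
  obtain P where P: "P \<subseteq># S" "size P = 3 * 3 ^ n" "zsum (3 ^ n) 3 P"
    using zsum_3_times[of n S] S q by (auto simp: diff_le_mono)
  have sub: "Z \<subseteq># S" if "Z \<subseteq># S - P" for Z
    using that by (meson diff_subset_eq_self subset_mset.order_trans)
  obtain Q where Q: "Q \<subseteq># S - P" "size Q = 3 * 3 ^ n" "zsum (3 ^ n) 3 Q"
  proof (rule ccontr)
    assume none: "\<not> thesis"
    \<comment> \<open>The length left after removing \<open>P\<close> fits \<open>j = 2\<close>. Of
      the multiples 1 to 4, 2 and 3 are excluded, and \<open>i - 1\<close> vanishes modulo 3 at 1
      and 4 but not at 0.\<close>
    have "3 dvd (0 :: int) - 1"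
    proof (rule three_dvd_at_0_of_zsum)
      show "size (S - P) = (2 + 3) * 3 ^ n - 3"
        using P S by (simp add: size_Diff_submset)
      show "(fdiff 1 ^^ 2) (\<lambda>i. i - 1) x = 0" for x
        by (simp add: eval_nat_numeral fdiff_def)
      fix i Z
      assume i: "0 < i" "i < (2::nat) + 3"
        and Z: "Z \<subseteq># S - P" "size Z = i * 3 ^ n" "zsum (3 ^ n) 3 Z"
      have "i \<noteq> 2" using no2 sub Z by blast
      moreover have "i \<noteq> 3" using none that Z by blast
      ultimately have "i \<in> {1, 4}" using i by auto
      then show "3 dvd int i - 1" by auto
    qed simp
    then show False by simp
  qed
  define T where "T = P + Q"
  have T: "T \<subseteq># S" "size T = 6 * 3 ^ n" "zsum (3 ^ n) 3 T"
    using P Q by (auto simp: T_def zsum_add)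
      (metis subset_mset.add_diff_inverse subset_mset.add_left_mono)
  have i3: "i = 3" if Z: "Z \<subseteq># T" "size Z = i * 3 ^ n" "zsum (3 ^ n) 3 Z" and i: "0 < i" "i < 6"
    for Z i
  proof -
    \<comment> \<open>Complementation in \<open>T\<close> swaps \<open>i\<close> and
      \<open>6 - i\<close>, so excluding 2 and 5 also excludes 4 and 1.\<close>
    have C: "T - Z \<subseteq># S" "size (T - Z) = (6 - i) * 3 ^ n" "zsum (3 ^ n) 3 (T - Z)"
      using Z T by (auto simp: size_Diff_submset diff_mult_distrib zsum_diff
          intro: subset_mset.order_trans[OF diff_subset_eq_self])
    have "Z \<subseteq># S" using Z T by auto
    then have "i \<noteq> 2" "i \<noteq> 5" "6 - i \<noteq> 2" "6 - i \<noteq> 5"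
      using no2[of Z] no5[of Z] no2[of "T - Z"] no5[of "T - Z"] Z C by auto
    with i show ?thesis by linarith
  qed
  \<comment> \<open>Making \<open>s\<close> compulsory removes the empty subsequence, whose value -3
    would cancel the value 3 of \<open>T\<close> in the signed sum, as \<open>6 * 3 ^ n\<close> is
    even. There remain \<open>6 * 3 ^ n - 1\<close> differences.\<close>
  obtain s T' where T': "T = add_mset s T'"
    using T(2) by (cases T) auto
  obtain xs where xs: "mset xs = T'" using ex_mset by blast
  obtain k where k: "n = Suc k" using assms(1) by (cases n) auto
  define f where "f = (\<lambda>i::int. i - 3)"
  let ?\<phi> = "test_fun (3 ^ n) f"
  have e: "embed s + (\<Sum>x\<in>#Z. embed x) = (\<Sum>x\<in>#add_mset s Z. embed x)" for Z
    by simp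
  have "9 dvd fdiffs (map embed xs) ?\<phi> (embed s)"
    unfolding k
  proof (rule nine_dvd_fdiffs_test_fun)
    show "(fdiff 1 ^^ 2) f x = 0" for x
      by (simp add: f_def eval_nat_numeral fdiff_def)
    show "6 * 3 ^ Suc k - 1 \<le> length (map embed xs)"
      using T(2) T' xs k by (auto simp flip: size_mset)
  qed
  also have "9 dvd fdiffs (map embed xs) ?\<phi> (embed s) \<longleftrightarrow>
      9 dvd ?\<phi> (embed s + (\<Sum>x\<in>#mset xs. embed x))"
  proof (rule dvd_fdiffs_iff_full)
    fix Z assume Z: "Z \<subset># mset xs"
    show "9 dvd ?\<phi> (embed s + (\<Sum>x\<in>#Z. embed x))"
    proof (cases "zsum (3 ^ n) 3 (add_mset s Z) \<and> 3 ^ n dvd size (add_mset s Z)")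
      case True
      then obtain i where i: "size (add_mset s Z) = i * 3 ^ n" by (auto elim: dvdE)
      have "add_mset s Z \<subset># T" using Z T' xs by simp
      then have "i * 3 ^ n < 6 * 3 ^ n" using mset_subset_size i T(2) by metis
      then have "i < 6" by simp
      moreover have "0 < i" using i by (cases i) auto
      ultimately have "i = 3"
        using i3[of "add_mset s Z" i] \<open>add_mset s Z \<subset># T\<close> i True
        by (simp add: subset_mset.less_imp_le)
      then show ?thesis using True i by (simp only: e test_fun_embed) (simp add: f_def)
    qed (simp only: e test_fun_embed, simp)
  qed
  also have "?\<phi> (embed s + (\<Sum>x\<in>#mset xs. embed x)) = 3"
    using T unfolding e xs T'[symmetric] by (simp add: test_fun_embed f_def)
  finally show False by simp
qed

section \<open>The zero-sum constant\<close>

lemma seq_sum_cyclic_power: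
  assumes "m > 0" "set_mset S \<subseteq> carrier (cyclic_power m r)"
  shows "seq_sum (cyclic_power m r) S = (\<lambda>i\<in>{..<r}. (\<Sum>x\<in>#S. x i) mod int m)"
  using assms(2)
proof (induction S)
  case empty
  interpret comm_group "cyclic_power m r" by (rule comm_group_cyclic_power)
  have "\<one>\<^bsub>cyclic_power m r\<^esub> = (\<lambda>i\<in>{..<r}. 0)"
    by (simp add: cyclic_power_def)
  then show ?case by (simp add: seq_sum_def)
next
  case (add x S)
  then show ?case
    by (simp add: comm_group.seq_sum_add_mset[OF comm_group_cyclic_power])
      (auto simp: cyclic_power_def fun_eq_iff mod_simps)
qed

lemma zero_sum_cyclic_power:
  assumes "m > 0" "set_mset S \<subseteq> carrier (cyclic_power m r)"
  shows "zero_sum (cyclic_power m r) S \<longleftrightarrow> zsum m r S"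
proof -
  have "\<one>\<^bsub>cyclic_power m r\<^esub> = (\<lambda>i\<in>{..<r}. 0)"
    by (simp add: cyclic_power_def)
  then show ?thesis
    unfolding zero_sum_def seq_sum_cyclic_power[OF assms] zsum_def
    by (auto simp: fun_eq_iff restrict_def mod_eq_0_iff_dvd)
qed

section \<open>The lower bound\<close>

lemma long_sequence_without_zsum:
  assumes "m > 1" "k > 0"
  obtains S where "set_mset S \<subseteq> carrier (cyclic_power m r)" "size S = k * m + r * (m - 1) - 1"
    "\<forall>T. T \<subseteq># S \<and> size T = k * m \<longrightarrow> \<not> zsum m r T"
proof
  \<comment> \<open>No coordinate has index \<open>r\<close>, so \<open>e r\<close> is the zero
    vector; the others are the unit vectors.\<close>
  define e :: "nat \<Rightarrow> nat \<Rightarrow> int" where "e j = (\<lambda>i\<in>{..<r}. if i = j then 1 else 0)" for j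
  define S where "S = replicate_mset (k * m - 1) (e r) + (\<Sum>j<r. replicate_mset (m - 1) (e j))"
  have set: "set_mset S \<subseteq> e ` {..r}"
    by (auto simp: S_def set_mset_sum)
  show "set_mset S \<subseteq> carrier (cyclic_power m r)"
    using set assms(1)
    by (auto simp: cyclic_power_def carrier_integer_mod_group e_def split: if_splits)
  have "k * m > 0" using assms by simp
  then show "size S = k * m + r * (m - 1) - 1"
    by (simp add: S_def size_multiset_sum)
  have e_apply: "e i j = (if j = i then 1 else 0)" if "j < r" for i j
    using that by (simp add: e_def)
  then have e_inj: "e j = e i \<longleftrightarrow> j = i" if "j < r" for i j
    using that by (metis zero_neq_one)
  have e_eq: "e i j = (if e i = e j then 1 else 0)" if "j < r" for i j
    using that e_apply e_inj by metis
  show "\<forall>T. T \<subseteq># S \<and> size T = k * m \<longrightarrow> \<not> zsum m r T"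
  proof (intro allI impI notI, elim conjE)
    fix T assume T: "T \<subseteq># S" "size T = k * m" and zs: "zsum m r T"
    have count_e: "count S (e j) = m - 1" if "j < r" for j
    proof -
      have "e j \<noteq> e r" using that e_inj by simp
      then show ?thesis using that by (simp add: S_def count_sum e_inj)
    qed
    \<comment> \<open>Coordinate \<open>j\<close> of the sum counts the copies of
      \<open>e j\<close>, and a multiple of \<open>m\<close> below \<open>m\<close> is 0. Hence
      \<open>T\<close> would consist of zero vectors, of which there are too few.\<close>
    have zero: "count T (e j) = 0" if "j < r" for j
    proof -
      have "(\<Sum>x\<in>#T. x j) = (\<Sum>x\<in>#T. if x = e j then 1 else 0)"
      proof (intro arg_cong[of _ _ sum_mset] image_mset_cong)
        fix x assume "x \<in># T"
        then obtain i where "x = e i"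
          using subset_trans[OF set_mset_mono[OF T(1)] set] by auto
        then show "x j = (if x = e j then 1 else 0)" using e_eq[OF that] by simp
      qed
      also have "\<dots> = int (count T (e j))"
        by (simp add: sum_mset_delta)
      finally have "m dvd count T (e j)" using zs that by (auto simp: zsum_def)
      moreover have "count T (e j) < m"
        using mset_subset_eq_count[OF T(1), of "e j"] count_e[OF that] assms(1) by simp
      ultimately show ?thesis by (metis dvd_imp_le gr0I not_le)
    qed
    have "T \<subseteq># replicate_mset (k * m - 1) (e r)"
    proof (rule mset_subset_eqI)
      fix x
      show "count T x \<le> count (replicate_mset (k * m - 1) (e r)) x"
      proof (cases "x \<in> e ` {..<r}")
        case True
        then have "count T x = 0" using zero by auto
        then show ?thesis by simp
      next
        case False
        then have "count S x = count (replicate_mset (k * m - 1) (e r)) x"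
          by (auto simp: S_def count_sum)
        then show ?thesis using mset_subset_eq_count[OF T(1), of x] by simp
      qed
    qed
    then have "size T \<le> k * m - 1" by (metis size_mset_mono size_replicate_mset)
    then show False using T(2) \<open>k * m > 0\<close> by linarith
  qed
qed

theorem theorem1p3:
  fixes n k :: nat
  assumes "n \<ge> 1" and "k \<in> {3, 5}"
  shows "zs_const (k * 3 ^ n) (cyclic_power (3 ^ n) 3) = (k + 3) * 3 ^ n - 3"
  unfolding zs_const_def
proof (rule Least_equality)
  let ?G = "cyclic_power (3 ^ n) 3" and ?q = "3 ^ n :: nat"
  have q: "?q \<ge> 3"
    using assms(1) power_increasing[of 1 n "3::nat"] by simp
  show "\<forall>S. set_mset S \<subseteq> carrier ?G \<and> size S = (k + 3) * 3 ^ n - 3 \<longrightarrow>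
      (\<exists>T. T \<subseteq># S \<and> size T = k * 3 ^ n \<and> zero_sum ?G T)"
  proof (intro allI impI)
    fix S assume S: "set_mset S \<subseteq> carrier ?G \<and> size S = (k + 3) * 3 ^ n - 3"
    have "\<exists>T. T \<subseteq># S \<and> size T = k * 3 ^ n \<and> zsum ?q 3 T"
    proof (cases "k = 3")
      case True
      then show ?thesis using S zsum_3_times[of n S] by simp
    next
      case False
      then show ?thesis using assms S zsum_5_times[of n S] by simp
    qed
    then obtain T where T: "T \<subseteq># S" "size T = k * 3 ^ n" "zsum ?q 3 T" by blast
    moreover have "set_mset T \<subseteq> carrier ?G"
      using set_mset_mono[OF T(1)] S by (simp add: subset_trans)
    ultimately show "\<exists>T. T \<subseteq># S \<and> size T = k * 3 ^ n \<and> zero_sum ?G T"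
      using zero_sum_cyclic_power[of ?q T 3] by auto
  qed
  fix l
  assume l: "\<forall>S. set_mset S \<subseteq> carrier ?G \<and> size S = l \<longrightarrow>
      (\<exists>T. T \<subseteq># S \<and> size T = k * 3 ^ n \<and> zero_sum ?G T)"
  show "(k + 3) * 3 ^ n - 3 \<le> l"
  proof (rule ccontr)
    assume "\<not> ?thesis"
    moreover have "?q > 1" "k > 0" using q assms(2) by auto
    then obtain S where S: "set_mset S \<subseteq> carrier ?G" "size S = k * ?q + 3 * (?q - 1) - 1"
      "\<forall>T. T \<subseteq># S \<and> size T = k * ?q \<longrightarrow> \<not> zsum ?q 3 T"
      by (rule long_sequence_without_zsum)
    moreover have "k * ?q + 3 * (?q - 1) = (k + 3) * ?q - 3"
      by (simp add: algebra_simps diff_mult_distrib2)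
    ultimately have "l \<le> size S" by linarith
    \<comment> \<open>A smaller \<open>l\<close> already fails on a part of \<open>S\<close>, whose
      subsequences are all subsequences of \<open>S\<close>.\<close>
    then obtain R where R: "R \<subseteq># S" "size R = l"
      by (rule submultiset_of_size)
    moreover have "set_mset R \<subseteq> carrier ?G" using set_mset_mono[OF R(1)] S(1) by (rule subset_trans)
    ultimately obtain T where T: "T \<subseteq># R" "size T = k * ?q" "zero_sum ?G T"
      using l by blast
    moreover have "set_mset T \<subseteq> carrier ?G"
      using set_mset_mono[OF T(1)] \<open>set_mset R \<subseteq> carrier ?G\<close> by (rule subset_trans)
    ultimately have "zsum ?q 3 T" using zero_sum_cyclic_power[of ?q T 3] by simp
    then show False using S(3) T R(1) by (meson subset_mset.order_trans)
  qed
qed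

end
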